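(* Let $\mathcal{S}$ be any subset of $\mathcal{S}_I$ with the property that for any $\zeta\in\mathcal{C}$ there exist $x_I\in\mathcal{S}$ and $x_C\in\mathbb{R}_+^{n-r}$ such that $C_I^{1:\ell}x_I+C_C^{1:\ell}x_C\le\zeta$, $A_Ix_I+A_Cx_C=b$, and $c^0_Ix_I+c^0_Cx_C=z(\zeta)$. Then for any $\zeta\in\mathcal{C}$ we have $$z(\zeta)=\min_{x_I\in\mathcal{S}_I}\bar z(\zeta;x_I)=\min_{x_I\in\mathcal{S}}\bar z(\zeta;x_I).$$
   Context: Data: $A\in\mathbb{Q}^{m\times n}$, $b\in\mathbb{Q}^m$, and $C\in\mathbb{Q}^{(\ell+1)\times n}$ with rows $c^0,c^1,\dots,c^\ell$; $C^{1:\ell}$ is the submatrix of $C$ with rows $c^1,\dots,c^\ell$. The first $r$ variables are integer and the last $n-r$ are continuous; a subscript $I$ (resp. $C$) on a matrix or row vector denotes its columns corresponding to the integer (resp. continuous) variables. The set $X_{\rm MO}=\{(x_I,x_C)\in\mathbb{Z}_+^r\times\mathbb{R}_+^{n-r}: A_Ix_I+A_Cx_C=b\}$ is assumed bounded. For $\zeta\in\mathbb{R}^\ell$ let $\mathcal{S}(\zeta)=\{(x_I,x_C)\in X_{\rm MO}: C_I^{1:\ell}x_I+C_C^{1:\ell}x_C\le\zeta\}$ and $\mathcal{C}=\{\zeta\in\mathbb{R}^\ell:\mathcal{S}(\zeta)\ne\emptyset\}$. The restricted value function (RVF) is $z(\zeta)=\inf_{(x_I,x_C)\in\mathcal{S}(\zeta)}c^0_Ix_I+c^0_Cx_C$,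 with $z(\zeta)=+\infty$ for $\zeta\notin\mathcal{C}$. Let $\mathcal{S}_I=\bigcup_{\zeta\in\mathcal{C}}\{x_I\in\mathbb{Z}_+^r:\exists x_C,\ (x_I,x_C)\in\mathcal{S}(\zeta)\}$. For $\beta\in\mathbb{R}^m$ let $z_{\rm LP}(\zeta;\beta)=\inf\{c^0_Cx_C: C_C^{1:\ell}x_C\le\zeta,\ A_Cx_C=\beta,\ x_C\in\mathbb{R}_+^{n-r}\}$ ($+\infty$ if infeasible). For $x_I\in\mathcal{S}_I$ the bounding function is $\bar z(\zeta;x_I)=c^0_Ix_I+z_{\rm LP}(\zeta-C_I^{1:\ell}x_I;\ b-A_Ix_I)$. *)

theory Defs
  imports "Jordan_Normal_Form.Matrix" "HOL-Library.Extended_Real"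
begin

text \<open>
  The instance data \<open>A\<close>, \<open>b\<close>, \<open>C\<close> are real matrices and vectors (rationality is a separate
  hypothesis), and \<open>r\<close> is the number of integer variables. The rows of \<open>C\<close> are numbered from 0,
  so that \<open>row C i\<close> is $c^i$. The dimensions $n$ and $\ell$ are read off as \<open>dim_col C\<close> and
  \<open>dim_row C - 1\<close>.
\<close>

definition int_cols :: "nat \<Rightarrow> real mat \<Rightarrow> real mat" where
  "int_cols r M = mat (dim_row M) r (\<lambda>(i, j). M $$ (i, j))"

definition cont_cols :: "nat \<Rightarrow> real mat \<Rightarrow> real mat" where
  "cont_cols r M = mat (dim_row M) (dim_col M - r) (\<lambda>(i, j). M $$ (i, r + j))"

definition int_part :: "nat \<Rightarrow> real vec \<Rightarrow> real vec" where
  "int_part r v = vec_first v r"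

definition cont_part :: "nat \<Rightarrow> real vec \<Rightarrow> real vec" where
  "cont_part r v = vec_last v (dim_vec v - r)"

text \<open>$C^{1:\ell}$\<close>
definition lower_rows :: "real mat \<Rightarrow> real mat" where
  "lower_rows M = mat (dim_row M - 1) (dim_col M) (\<lambda>(i, j). M $$ (Suc i, j))"

text \<open>$\mathbb{Z}_+^k$, embedded in $\mathbb{R}^k$\<close>
definition nonneg_int_vecs :: "nat \<Rightarrow> real vec set" where
  "nonneg_int_vecs k = {x \<in> carrier_vec k. \<forall>i<k. x $ i \<in> \<int> \<and> 0 \<le> x $ i}"

definition nonneg_real_vecs :: "nat \<Rightarrow> real vec set" where
  "nonneg_real_vecs k = {x \<in> carrier_vec k. \<forall>i<k. 0 \<le> x $ i}"

definition X_MO :: "real mat \<Rightarrow> real vec \<Rightarrow> nat \<Rightarrow> (real vec \<times> real vec) set" where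
  "X_MO A b r = {(xI, xC). xI \<in> nonneg_int_vecs r \<and> xC \<in> nonneg_real_vecs (dim_col A - r) \<and>
     int_cols r A *\<^sub>v xI + cont_cols r A *\<^sub>v xC = b}"

text \<open>Boundedness in the maximum norm; \<open>real vec\<close> carries no metric.\<close>
definition bounded_vecs :: "real vec set \<Rightarrow> bool" where
  "bounded_vecs X \<longleftrightarrow> (\<exists>B. \<forall>x\<in>X. \<forall>i<dim_vec x. \<bar>x $ i\<bar> \<le> B)"

text \<open>$\mathcal{S}(\zeta)$; the order on \<open>real vec\<close> is componentwise (and requires equal dimensions).\<close>
definition feasible ::
  "real mat \<Rightarrow> real vec \<Rightarrow> real mat \<Rightarrow> nat \<Rightarrow> real vec \<Rightarrow> (real vec \<times> real vec) set" where
  "feasible A b C r \<zeta> = {(xI, xC) \<in> X_MO A b r.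
     int_cols r (lower_rows C) *\<^sub>v xI + cont_cols r (lower_rows C) *\<^sub>v xC \<le> \<zeta>}"

text \<open>$\mathcal{C}$\<close>
definition rhs_dom :: "real mat \<Rightarrow> real vec \<Rightarrow> real mat \<Rightarrow> nat \<Rightarrow> real vec set" where
  "rhs_dom A b C r = {\<zeta> \<in> carrier_vec (dim_row C - 1). feasible A b C r \<zeta> \<noteq> {}}"

definition objective :: "real mat \<Rightarrow> nat \<Rightarrow> real vec \<Rightarrow> real vec \<Rightarrow> real" where
  "objective C r xI xC = int_part r (row C 0) \<bullet> xI + cont_part r (row C 0) \<bullet> xC"

text \<open>
  The restricted value function $z$. The infimum over the empty set in \<open>ereal\<close> is \<open>\<infinity>\<close>, here and
  in \<open>z_LP\<close>.
\<close>
definition rvf :: "real mat \<Rightarrow> real vec \<Rightarrow> real mat \<Rightarrow> nat \<Rightarrow> real vec \<Rightarrow> ereal" where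
  "rvf A b C r \<zeta> = (INF (xI, xC)\<in>feasible A b C r \<zeta>. ereal (objective C r xI xC))"

text \<open>$\mathcal{S}_I$\<close>
definition int_projection :: "real mat \<Rightarrow> real vec \<Rightarrow> real mat \<Rightarrow> nat \<Rightarrow> real vec set" where
  "int_projection A b C r =
     (\<Union>\<zeta>\<in>rhs_dom A b C r. {xI \<in> nonneg_int_vecs r. \<exists>xC. (xI, xC) \<in> feasible A b C r \<zeta>})"

definition z_LP :: "real mat \<Rightarrow> real mat \<Rightarrow> nat \<Rightarrow> real vec \<Rightarrow> real vec \<Rightarrow> ereal" where
  "z_LP A C r \<zeta> \<beta> =
     (INF xC\<in>{xC \<in> nonneg_real_vecs (dim_col A - r).
                cont_cols r (lower_rows C) *\<^sub>v xC \<le> \<zeta> \<and> cont_cols r A *\<^sub>v xC = \<beta>}.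
        ereal (cont_part r (row C 0) \<bullet> xC))"

text \<open>The bounding function $\bar z(\zeta; x_I)$\<close>
definition z_bar ::
  "real mat \<Rightarrow> real vec \<Rightarrow> real mat \<Rightarrow> nat \<Rightarrow> real vec \<Rightarrow> real vec \<Rightarrow> ereal" where
  "z_bar A b C r \<zeta> xI = ereal (int_part r (row C 0) \<bullet> xI) +
     z_LP A C r (\<zeta> - int_cols r (lower_rows C) *\<^sub>v xI) (b - int_cols r A *\<^sub>v xI)"

text \<open>
  \<open>v\<close> is the attained minimum of \<open>f\<close> over \<open>X\<close>. Unlike \<open>Min (f ` X)\<close>, this is meaningful without
  knowing that \<open>X\<close> is finite and nonempty.
\<close>
definition is_minimum :: "'b::linorder \<Rightarrow> ('a \<Rightarrow> 'b) \<Rightarrow> 'a set \<Rightarrow> bool" where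
  "is_minimum v f X \<longleftrightarrow> v \<in> f ` X \<and> (\<forall>x\<in>X. v \<le> f x)"

end

theory Submission
  imports Defs
begin

text \<open>
  Fixing the integer part \<open>xI\<close> turns the restricted problem into a linear program in \<open>xC\<close>, whose
  constraints are those of \<open>z_LP\<close> with \<open>xI\<close> moved to the right-hand sides. Hence
  \<open>z_bar \<zeta> xI\<close> is the infimum of the objective over the slice of \<open>feasible \<zeta>\<close> above \<open>xI\<close>
  (\<open>z_bar_eq_INF_slice\<close>). An infimum over a slice is at least the infimum over the whole
  set, so every \<open>z_bar \<zeta> xI\<close> bounds \<open>rvf \<zeta>\<close> from above, and it equals \<open>rvf \<zeta>\<close>
  whenever some optimal solution lies above \<open>xI\<close>. The hypothesis on \<open>S\<close> says that such an
  \<open>xI\<close> exists in \<open>S\<close>, hence also in the larger set \<open>int_projection\<close>.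
\<close>

lemma le_minus_vec_iff:
  fixes u v w :: "real vec"
  assumes "u \<in> carrier_vec k" and "v \<in> carrier_vec k" and "w \<in> carrier_vec k"
  shows "v \<le> w - u \<longleftrightarrow> u + v \<le> w"
proof -
  have "v $ i \<le> w $ i - u $ i \<longleftrightarrow> u $ i + v $ i \<le> w $ i" for i
    by linarith
  with assms show ?thesis
    by (simp add: less_eq_vec_def)
qed

lemma eq_minus_vec_iff:
  fixes u v w :: "real vec"
  assumes "u \<in> carrier_vec k" and "v \<in> carrier_vec k" and "w \<in> carrier_vec k"
  shows "v = w - u \<longleftrightarrow> u + v = w"
proof -
  have "v $ i = w $ i - u $ i \<longleftrightarrow> u $ i + v $ i = w $ i" for i
    by linarith
  with assms show ?thesis
    by (simp add: vec_eq_iff)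
qed

text \<open>
  Adding a real constant is an order automorphism of the extended reals, so it commutes with every
  infimum, also when that infimum is \<open>\<infinity>\<close> or \<open>-\<infinity>\<close>.
\<close>
lemma INF_ereal_add_left:
  fixes f :: "'a \<Rightarrow> ereal"
  shows "ereal c + (INF x\<in>X. f x) = (INF x\<in>X. ereal c + f x)"
proof (rule antisym)
  show "ereal c + (INF x\<in>X. f x) \<le> (INF x\<in>X. ereal c + f x)"
    by (intro INF_greatest add_left_mono INF_lower)
  have "(INF x\<in>X. ereal c + f x) - ereal c \<le> f x" if "x \<in> X" for x
    using INF_lower[OF that, of "\<lambda>x. ereal c + f x"]
    by (simp add: ereal_minus_le add.commute)
  then have "(INF x\<in>X. ereal c + f x) - ereal c \<le> (INF x\<in>X. f x)"
    by (rule INF_greatest)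
  then show "(INF x\<in>X. ereal c + f x) \<le> ereal c + (INF x\<in>X. f x)"
    by (simp add: ereal_minus_le add.commute)
qed

text \<open>
  The integer part contributes a real constant to the objective and shifts both right-hand sides.
  The identity also holds when the slice is empty: both sides are then \<open>\<infinity>\<close>.
\<close>
lemma z_bar_eq_INF_slice:
  assumes A: "A \<in> carrier_mat m n" and b: "b \<in> carrier_vec m"
    and \<zeta>: "\<zeta> \<in> carrier_vec (dim_row C - 1)" and xI: "xI \<in> nonneg_int_vecs r"
  shows "z_bar A b C r \<zeta> xI
    = (INF xC\<in>{xC. (xI, xC) \<in> feasible A b C r \<zeta>}. ereal (objective C r xI xC))"
proof -
  let ?B = "lower_rows C"
  have int_C: "int_cols r ?B *\<^sub>v xI \<in> carrier_vec (dim_row C - 1)"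
    by (rule carrier_vecI) (simp add: int_cols_def lower_rows_def)
  have cont_C: "cont_cols r ?B *\<^sub>v xC \<in> carrier_vec (dim_row C - 1)" for xC
    by (rule carrier_vecI) (simp add: cont_cols_def lower_rows_def)
  have int_A: "int_cols r A *\<^sub>v xI \<in> carrier_vec m"
    using A by (intro carrier_vecI) (simp add: int_cols_def)
  have cont_A: "cont_cols r A *\<^sub>v xC \<in> carrier_vec m" for xC
    using A by (intro carrier_vecI) (simp add: cont_cols_def)
  note ineq = le_minus_vec_iff[OF int_C cont_C \<zeta>] and eq = eq_minus_vec_iff[OF int_A cont_A b]
  have "{xC. (xI, xC) \<in> feasible A b C r \<zeta>} = {xC \<in> nonneg_real_vecs (dim_col A - r).
      cont_cols r ?B *\<^sub>v xC \<le> \<zeta> - int_cols r ?B *\<^sub>v xI \<and>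
      cont_cols r A *\<^sub>v xC = b - int_cols r A *\<^sub>v xI}"
    using xI by (auto simp: feasible_def X_MO_def ineq eq)
  then show ?thesis
    by (simp add: z_bar_def z_LP_def objective_def INF_ereal_add_left)
qed

theorem theorem1:
  fixes A C :: "real mat" and b :: "real vec" and m n r l :: nat and S :: "real vec set"
  assumes "A \<in> carrier_mat m n" and "b \<in> carrier_vec m" and "C \<in> carrier_mat (l + 1) n"
    and "r \<le> n"
    and "elements_mat A \<subseteq> \<rat>" and "set\<^sub>v b \<subseteq> \<rat>" and "elements_mat C \<subseteq> \<rat>"
    and "bounded_vecs ((\<lambda>(xI, xC). xI @\<^sub>v xC) ` X_MO A b r)"
    and "S \<subseteq> int_projection A b C r"
    and "\<forall>\<zeta>\<in>rhs_dom A b C r. \<exists>xI\<in>S. \<exists>xC\<in>nonneg_real_vecs (n - r).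
           int_cols r (lower_rows C) *\<^sub>v xI + cont_cols r (lower_rows C) *\<^sub>v xC \<le> \<zeta> \<and>
           int_cols r A *\<^sub>v xI + cont_cols r A *\<^sub>v xC = b \<and>
           ereal (int_part r (row C 0) \<bullet> xI + cont_part r (row C 0) \<bullet> xC) = rvf A b C r \<zeta>"
  shows "\<forall>\<zeta>\<in>rhs_dom A b C r.
           is_minimum (rvf A b C r \<zeta>) (z_bar A b C r \<zeta>) (int_projection A b C r) \<and>
           is_minimum (rvf A b C r \<zeta>) (z_bar A b C r \<zeta>) S"
proof
  fix \<zeta> assume dom: "\<zeta> \<in> rhs_dom A b C r"
  have slice: "z_bar A b C r \<zeta> xI
      = (INF xC\<in>{xC. (xI, xC) \<in> feasible A b C r \<zeta>}. ereal (objective C r xI xC))"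
    if "xI \<in> int_projection A b C r" for xI
    using that dom assms(1-2)
    by (intro z_bar_eq_INF_slice) (auto simp: int_projection_def rhs_dom_def)
  have lower: "rvf A b C r \<zeta> \<le> z_bar A b C r \<zeta> xI" if "xI \<in> int_projection A b C r" for xI
    unfolding slice[OF that] rvf_def by (intro INF_greatest) (force intro: INF_lower2)
  from assms(10) dom obtain xI xC where xI: "xI \<in> S" and xC: "xC \<in> nonneg_real_vecs (n - r)"
    and feas: "int_cols r (lower_rows C) *\<^sub>v xI + cont_cols r (lower_rows C) *\<^sub>v xC \<le> \<zeta>"
      "int_cols r A *\<^sub>v xI + cont_cols r A *\<^sub>v xC = b"
    and opt: "ereal (objective C r xI xC) = rvf A b C r \<zeta>"
    unfolding objective_def by blast
  have xI': "xI \<in> int_projection A b C r"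
    using xI assms(9) by blast
  then have "(xI, xC) \<in> feasible A b C r \<zeta>"
    using xC feas assms(1) by (auto simp: int_projection_def feasible_def X_MO_def)
  then have "z_bar A b C r \<zeta> xI \<le> rvf A b C r \<zeta>"
    unfolding slice[OF xI'] opt[symmetric] by (intro INF_lower) simp
  with lower[OF xI'] have "rvf A b C r \<zeta> = z_bar A b C r \<zeta> xI"
    by (rule antisym)
  with xI xI' lower assms(9)
  show "is_minimum (rvf A b C r \<zeta>) (z_bar A b C r \<zeta>) (int_projection A b C r) \<and>
      is_minimum (rvf A b C r \<zeta>) (z_bar A b C r \<zeta>) S"
    unfolding is_minimum_def by blast
qed

end
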